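(* For each guarded recursive specification $E$ over ACP (finite or infinite) and each $X\in\mathrm{vars}(E)$, there exists a finite or countably infinite linear recursive specification $E'$ over ACP (with $X\in\mathrm{vars}(E')$, so that the constant $\langle X|E'\rangle$ exists) such that $\mathrm{ACP}_{\mathrm{rec}}\vdash\langle X|E\rangle=\langle X|E'\rangle$.
   Context: **ACP.** Fix an arbitrary set $A$ of actions with $\delta \notin A$; put $A_\delta = A \cup \{\delta\}$. Fix an arbitrary commutative and associative function $\gamma : A_\delta \times A_\delta \to A_\delta$ with $\gamma(\delta,a) = \delta$ for all $a \in A_\delta$. The signature of ACP has: a constant $a$ for each $a \in A$; a constant $\delta$; binary operators $+$ (alternative composition), $\cdot$ (sequential composition), $\parallel$ (parallel composition), $\lfloor\!\lfloor$ (left merge), $\mid$ (communication merge); and a unary operator $\partial_H$ (encapsulation) for each $H \subseteq A$. Fix an infinite set $\mathcal{X}$ of variables. ACP terms are the terms over this signature with variables in $\mathcal{X}$. Precedence: $+$ binds weakest, $\cdot$ binds strongest. The axioms of ACP are the following equations, where $a,b$ range over the constants of ACP (i.e. over $A_\delta$), $H$ over subsets of $A$, and $x,y,z$ are variables: $x+y=y+x$; $(x+y)+z=x+(y+z)$; $x+x=x$; $(x+y)\cdot z=x\cdot z+y\cdot z$; $(x\cdot y)\cdot z=x\cdot(y\cdot z)$; $x+\delta=x$; $\delta\cdot x=\delta$; $\partial_H(a)=a$ if $a\notin H$; $\partial_H(a)=\delta$ if $a\in H$; $\partial_H(x+y)=\partial_H(x)+\partial_H(y)$; $\partial_H(x\cdot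 y)=\partial_H(x)\cdot\partial_H(y)$; $x\parallel y=x\lfloor\!\lfloor y+y\lfloor\!\lfloor x+x\mid y$; $a\lfloor\!\lfloor x=a\cdot x$; $a\cdot x\lfloor\!\lfloor y=a\cdot(x\parallel y)$; $(x+y)\lfloor\!\lfloor z=x\lfloor\!\lfloor z+y\lfloor\!\lfloor z$; $a\cdot x\mid b=(a\mid b)\cdot x$; $a\mid b\cdot x=(a\mid b)\cdot x$; $a\cdot x\mid b\cdot y=(a\mid b)\cdot(x\parallel y)$; $(x+y)\mid z=x\mid z+y\mid z$; $x\mid(y+z)=x\mid y+x\mid z$; $a\mid b=\gamma(a,b)$. **Guarded recursion.** An occurrence of a variable $X$ in a term $t$ is guarded if $t$ has a subterm of the form $a\cdot t'$ with $a\in A$ such that $t'$ contains this occurrence. A term is guarded if all occurrences of variables in it are guarded. A guarded recursive specification over ACP is a set $E=\{X_i=t_i\mid i\in I\}$, with $I$ a finite or infinite (possibly uncountable) set, the $X_i\in\mathcal{X}$ pairwise distinct, each $t_i$ an ACP term in which only variables from $\{X_j\mid j\in I\}$ occur, such that each $t_i$ either is a guarded ACP term or can be rewritten (in finitely many steps) to a guarded ACP term in which only variables from $\{X_j\mid j\in I\}$ occur, using the axioms of ACP in either direction and/or the equations $X_j=t_j$ with $j\in I$, $j\neq i$, from left to right. $\mathrm{vars}(E)$ is the set of variables occurring in $E$. **$\mathrm{ACP}_{\mathrm{rec}}$.** The signature of ACP is extended with a constant $\langle X|E\rangle$ for each guarded recursive specification $E$ over ACP and each $X\in\mathrm{vars}(E)$.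 For an ACP term $t$, $\langle t|E\rangle$ denotes $t$ with every occurrence of each $X\in\mathrm{vars}(E)$ replaced by $\langle X|E\rangle$. The axioms of $\mathrm{ACP}_{\mathrm{rec}}$ are those of ACP together with: RDP: $\langle X|E\rangle=\langle t|E\rangle$ whenever $X=t$ is in $E$; RSP: the conditional equation $E\Rightarrow X=\langle X|E\rangle$ (premises: all equations in $E$) for each $X\in\mathrm{vars}(E)$. $\mathrm{ACP}_{\mathrm{rec}}$ terms are terms over the extended signature (the constants $\langle X|E\rangle$ contain no free variables). **Derivability.** $\mathrm{ACP}_{\mathrm{rec}}\vdash t=t'$ means that $t=t'$ is derivable from the axioms of $\mathrm{ACP}_{\mathrm{rec}}$ in infinitary conditional equational logic: the set of derivable equations is the least set of equations between $\mathrm{ACP}_{\mathrm{rec}}$ terms that contains all substitution instances of the unconditional axioms, is closed under reflexivity, symmetry, transitivity and congruence for all operators, and contains the substitution instance under $\sigma$ of the conclusion of a conditional axiom whenever it contains the instances under $\sigma$ of all (possibly infinitely many) its premises. Derivation trees may be infinitely branching but have no infinite branches. **Linear recursive specifications.** The set of linear ACP terms is the least set containing $\delta$, each $a\in A$, and each $a\cdot X$ with $a\in A$, $X\in\mathcal{X}$, and closed under $+$. A linear recursive specification over ACP is a guarded recursive specification $E$ over ACP such that for each equation $X=t$ in $E$, $t$ is a linear ACP term. It is finite or countably infinite if it is so as a set of equations. *)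

theory Defs
  imports Main "HOL-Library.Countable_Set"
begin

text \<open>
  The elements of \<open>A\<^sub>\<delta> = A \<union> {\<delta>}\<close> are the constants \<open>Const a\<close>.
  The leaves \<open>Var v\<close> are kept generic: with \<open>'v\<close> the type of variables one obtains the terms of ACP,
  with \<open>'v\<close> the type \<open>leaf\<close> below, which adds the constants \<open>\<langle>X|E\<rangle>\<close>, those of ACP with recursion.
  Neither membership of the constants in \<open>A\<^sub>\<delta>\<close> nor \<open>H \<subseteq> A\<close> in \<open>Encap H\<close> is
  enforced by the type; see \<open>acp_term\<close> and \<open>rec_term\<close>.
\<close>

datatype ('a, leaves: 'v) trm =
    Var 'v
  | Const 'a
  | Alt "('a, 'v) trm" "('a, 'v) trm"  (infixl "\<^bold>+" 65)
  | Seq "('a, 'v) trm" "('a, 'v) trm"  (infixr "\<^bold>\<cdot>" 80)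
  | Par "('a, 'v) trm" "('a, 'v) trm"  (infixl "\<^bold>\<parallel>" 70)
  | LMerge "('a, 'v) trm" "('a, 'v) trm"  (infixl "\<^bold>\<lfloor>\<^bold>\<lfloor>" 70)
  | Comm "('a, 'v) trm" "('a, 'v) trm"  (infixl "\<^bold>\<bar>" 70)
  | Encap "'a set" "('a, 'v) trm"

primrec subst :: "('v \<Rightarrow> ('a, 'w) trm) \<Rightarrow> ('a, 'v) trm \<Rightarrow> ('a, 'w) trm" where
  "subst \<sigma> (Var v) = \<sigma> v"
| "subst \<sigma> (Const a) = Const a"
| "subst \<sigma> (s \<^bold>+ t) = subst \<sigma> s \<^bold>+ subst \<sigma> t"
| "subst \<sigma> (s \<^bold>\<cdot> t) = subst \<sigma> s \<^bold>\<cdot> subst \<sigma> t"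
| "subst \<sigma> (s \<^bold>\<parallel> t) = subst \<sigma> s \<^bold>\<parallel> subst \<sigma> t"
| "subst \<sigma> (s \<^bold>\<lfloor>\<^bold>\<lfloor> t) = subst \<sigma> s \<^bold>\<lfloor>\<^bold>\<lfloor> subst \<sigma> t"
| "subst \<sigma> (s \<^bold>\<bar> t) = subst \<sigma> s \<^bold>\<bar> subst \<sigma> t"
| "subst \<sigma> (Encap H t) = Encap H (subst \<sigma> t)"

primrec args :: "('a, 'v) trm \<Rightarrow> ('a, 'v) trm list" where
  "args (Var v) = []"
| "args (Const a) = []"
| "args (s \<^bold>+ t) = [s, t]"
| "args (s \<^bold>\<cdot> t) = [s, t]"
| "args (s \<^bold>\<parallel> t) = [s, t]"
| "args (s \<^bold>\<lfloor>\<^bold>\<lfloor> t) = [s, t]"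
| "args (s \<^bold>\<bar> t) = [s, t]"
| "args (Encap H t) = [t]"

text \<open>Occurrences are identified with positions, i.e. paths of argument indices from the root.\<close>

fun subterm_at :: "('a, 'v) trm \<Rightarrow> nat list \<Rightarrow> ('a, 'v) trm option" where
  "subterm_at t [] = Some t"
| "subterm_at t (i # p) = (if i < length (args t) then subterm_at (args t ! i) p else None)"

text \<open>
  A recursive specification \<open>{X\<^sub>i = t\<^sub>i | i \<in> I}\<close> with pairwise distinct \<open>X\<^sub>i\<close> is the partial map
  sending each \<open>X\<^sub>i\<close> to \<open>t\<^sub>i\<close>; its set of equations is \<open>Map.graph E\<close>.
\<close>

type_synonym ('a, 'x) spec = "'x \<rightharpoonup> ('a, 'x) trm"

definition spec_vars :: "('a, 'x) spec \<Rightarrow> 'x set" where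
  "spec_vars E = dom E \<union> (\<Union>t\<in>ran E. leaves t)"

datatype ('a, 'x) leaf = FVar 'x | RecConst 'x "('a, 'x) spec"

type_synonym ('a, 'x) rtrm = "('a, ('a, 'x) leaf) trm"

abbreviation rec_const :: "'x \<Rightarrow> ('a, 'x) spec \<Rightarrow> ('a, 'x) rtrm"  ("\<langle>_|_\<rangle>") where
  "\<langle>X|E\<rangle> \<equiv> Var (RecConst X E)"

definition close_trm :: "('a, 'x) trm \<Rightarrow> ('a, 'x) spec \<Rightarrow> ('a, 'x) rtrm" where
  "close_trm t E = subst (\<lambda>X. if X \<in> spec_vars E then \<langle>X|E\<rangle> else Var (FVar X)) t"

locale acp =
  fixes A :: "'a set" and \<delta> :: 'a and \<gamma> :: "'a \<Rightarrow> 'a \<Rightarrow> 'a"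
  assumes delta_notin: "\<delta> \<notin> A"
    and gamma_closed: "a \<in> insert \<delta> A \<Longrightarrow> b \<in> insert \<delta> A \<Longrightarrow> \<gamma> a b \<in> insert \<delta> A"
    and gamma_commute: "a \<in> insert \<delta> A \<Longrightarrow> b \<in> insert \<delta> A \<Longrightarrow> \<gamma> a b = \<gamma> b a"
    and gamma_assoc: "a \<in> insert \<delta> A \<Longrightarrow> b \<in> insert \<delta> A \<Longrightarrow> c \<in> insert \<delta> A \<Longrightarrow>
      \<gamma> (\<gamma> a b) c = \<gamma> a (\<gamma> b c)"
    and gamma_delta: "a \<in> insert \<delta> A \<Longrightarrow> \<gamma> \<delta> a = \<delta>"
begin

abbreviation A\<delta> :: "'a set" where
  "A\<delta> \<equiv> insert \<delta> A"

primrec acp_term :: "('a, 'v) trm \<Rightarrow> bool" where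
  "acp_term (Var v) \<longleftrightarrow> True"
| "acp_term (Const a) \<longleftrightarrow> a \<in> A\<delta>"
| "acp_term (s \<^bold>+ t) \<longleftrightarrow> acp_term s \<and> acp_term t"
| "acp_term (s \<^bold>\<cdot> t) \<longleftrightarrow> acp_term s \<and> acp_term t"
| "acp_term (s \<^bold>\<parallel> t) \<longleftrightarrow> acp_term s \<and> acp_term t"
| "acp_term (s \<^bold>\<lfloor>\<^bold>\<lfloor> t) \<longleftrightarrow> acp_term s \<and> acp_term t"
| "acp_term (s \<^bold>\<bar> t) \<longleftrightarrow> acp_term s \<and> acp_term t"
| "acp_term (Encap H t) \<longleftrightarrow> H \<subseteq> A \<and> acp_term t"

text \<open>
  The substitution instances of the axioms of ACP. The terms substituted for \<open>x\<close>, \<open>y\<close>, \<open>z\<close> are not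
  restricted to the signature here; wherever the axioms are used, both sides of the instance
  are required to be over the signature, and every variable occurs in one of them.
\<close>

inductive axiom_inst :: "('a, 'v) trm \<Rightarrow> ('a, 'v) trm \<Rightarrow> bool" where
  A1: "axiom_inst (x \<^bold>+ y) (y \<^bold>+ x)"
| A2: "axiom_inst ((x \<^bold>+ y) \<^bold>+ z) (x \<^bold>+ (y \<^bold>+ z))"
| A3: "axiom_inst (x \<^bold>+ x) x"
| A4: "axiom_inst ((x \<^bold>+ y) \<^bold>\<cdot> z) (x \<^bold>\<cdot> z \<^bold>+ y \<^bold>\<cdot> z)"
| A5: "axiom_inst ((x \<^bold>\<cdot> y) \<^bold>\<cdot> z) (x \<^bold>\<cdot> (y \<^bold>\<cdot> z))"
| A6: "axiom_inst (x \<^bold>+ Const \<delta>) x"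
| A7: "axiom_inst (Const \<delta> \<^bold>\<cdot> x) (Const \<delta>)"
| D1: "a \<in> A\<delta> \<Longrightarrow> H \<subseteq> A \<Longrightarrow> a \<notin> H \<Longrightarrow> axiom_inst (Encap H (Const a)) (Const a)"
| D2: "a \<in> A\<delta> \<Longrightarrow> H \<subseteq> A \<Longrightarrow> a \<in> H \<Longrightarrow> axiom_inst (Encap H (Const a)) (Const \<delta>)"
| D3: "H \<subseteq> A \<Longrightarrow> axiom_inst (Encap H (x \<^bold>+ y)) (Encap H x \<^bold>+ Encap H y)"
| D4: "H \<subseteq> A \<Longrightarrow> axiom_inst (Encap H (x \<^bold>\<cdot> y)) (Encap H x \<^bold>\<cdot> Encap H y)"
| CM1: "axiom_inst (x \<^bold>\<parallel> y) ((x \<^bold>\<lfloor>\<^bold>\<lfloor> y) \<^bold>+ (y \<^bold>\<lfloor>\<^bold>\<lfloor> x) \<^bold>+ (x \<^bold>\<bar> y))"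
| CM2: "a \<in> A\<delta> \<Longrightarrow> axiom_inst (Const a \<^bold>\<lfloor>\<^bold>\<lfloor> x) (Const a \<^bold>\<cdot> x)"
| CM3: "a \<in> A\<delta> \<Longrightarrow> axiom_inst ((Const a \<^bold>\<cdot> x) \<^bold>\<lfloor>\<^bold>\<lfloor> y) (Const a \<^bold>\<cdot> (x \<^bold>\<parallel> y))"
| CM4: "axiom_inst ((x \<^bold>+ y) \<^bold>\<lfloor>\<^bold>\<lfloor> z) ((x \<^bold>\<lfloor>\<^bold>\<lfloor> z) \<^bold>+ (y \<^bold>\<lfloor>\<^bold>\<lfloor> z))"
| CM5: "a \<in> A\<delta> \<Longrightarrow> b \<in> A\<delta> \<Longrightarrow>
    axiom_inst ((Const a \<^bold>\<cdot> x) \<^bold>\<bar> Const b) ((Const a \<^bold>\<bar> Const b) \<^bold>\<cdot> x)"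
| CM6: "a \<in> A\<delta> \<Longrightarrow> b \<in> A\<delta> \<Longrightarrow>
    axiom_inst (Const a \<^bold>\<bar> (Const b \<^bold>\<cdot> x)) ((Const a \<^bold>\<bar> Const b) \<^bold>\<cdot> x)"
| CM7: "a \<in> A\<delta> \<Longrightarrow> b \<in> A\<delta> \<Longrightarrow>
    axiom_inst ((Const a \<^bold>\<cdot> x) \<^bold>\<bar> (Const b \<^bold>\<cdot> y)) ((Const a \<^bold>\<bar> Const b) \<^bold>\<cdot> (x \<^bold>\<parallel> y))"
| CM8: "axiom_inst ((x \<^bold>+ y) \<^bold>\<bar> z) ((x \<^bold>\<bar> z) \<^bold>+ (y \<^bold>\<bar> z))"
| CM9: "axiom_inst (x \<^bold>\<bar> (y \<^bold>+ z)) ((x \<^bold>\<bar> y) \<^bold>+ (x \<^bold>\<bar> z))"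
| CF: "a \<in> A\<delta> \<Longrightarrow> b \<in> A\<delta> \<Longrightarrow> axiom_inst (Const a \<^bold>\<bar> Const b) (Const (\<gamma> a b))"

text \<open>
  The occurrence at position \<open>p\<close> lies inside the second argument of a subterm \<open>a \<cdot> t'\<close> with
  \<open>a \<in> A\<close>, the subterm being at position \<open>q\<close>.
\<close>

definition guarded_occ :: "('a, 'v) trm \<Rightarrow> nat list \<Rightarrow> bool" where
  "guarded_occ t p \<longleftrightarrow>
     (\<exists>q r a t'. p = q @ 1 # r \<and> a \<in> A \<and> subterm_at t q = Some (Const a \<^bold>\<cdot> t'))"

definition guarded :: "('a, 'v) trm \<Rightarrow> bool" where
  "guarded t \<longleftrightarrow> (\<forall>p X. subterm_at t p = Some (Var X) \<longrightarrow> guarded_occ t p)"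

text \<open>
  One rewrite step for the right-hand side of the equation for \<open>X\<close> in \<open>E\<close>: the equation
  for \<open>X\<close> itself may not be used.
\<close>

inductive rewr :: "('a, 'x) spec \<Rightarrow> 'x \<Rightarrow> ('a, 'x) trm \<Rightarrow> ('a, 'x) trm \<Rightarrow> bool"
  for E :: "('a, 'x) spec" and X :: 'x where
  ax_lr: "axiom_inst s t \<Longrightarrow> acp_term s \<Longrightarrow> acp_term t \<Longrightarrow> rewr E X s t"
| ax_rl: "axiom_inst t s \<Longrightarrow> acp_term s \<Longrightarrow> acp_term t \<Longrightarrow> rewr E X s t"
| unfold: "Y \<noteq> X \<Longrightarrow> E Y = Some t \<Longrightarrow> rewr E X (Var Y) t"
| Alt1: "rewr E X s s' \<Longrightarrow> rewr E X (s \<^bold>+ t) (s' \<^bold>+ t)"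
| Alt2: "rewr E X t t' \<Longrightarrow> rewr E X (s \<^bold>+ t) (s \<^bold>+ t')"
| Seq1: "rewr E X s s' \<Longrightarrow> rewr E X (s \<^bold>\<cdot> t) (s' \<^bold>\<cdot> t)"
| Seq2: "rewr E X t t' \<Longrightarrow> rewr E X (s \<^bold>\<cdot> t) (s \<^bold>\<cdot> t')"
| Par1: "rewr E X s s' \<Longrightarrow> rewr E X (s \<^bold>\<parallel> t) (s' \<^bold>\<parallel> t)"
| Par2: "rewr E X t t' \<Longrightarrow> rewr E X (s \<^bold>\<parallel> t) (s \<^bold>\<parallel> t')"
| LMerge1: "rewr E X s s' \<Longrightarrow> rewr E X (s \<^bold>\<lfloor>\<^bold>\<lfloor> t) (s' \<^bold>\<lfloor>\<^bold>\<lfloor> t)"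
| LMerge2: "rewr E X t t' \<Longrightarrow> rewr E X (s \<^bold>\<lfloor>\<^bold>\<lfloor> t) (s \<^bold>\<lfloor>\<^bold>\<lfloor> t')"
| Comm1: "rewr E X s s' \<Longrightarrow> rewr E X (s \<^bold>\<bar> t) (s' \<^bold>\<bar> t)"
| Comm2: "rewr E X t t' \<Longrightarrow> rewr E X (s \<^bold>\<bar> t) (s \<^bold>\<bar> t')"
| Encap: "rewr E X t t' \<Longrightarrow> rewr E X (Encap H t) (Encap H t')"

text \<open>
  Zero rewrite steps cover the case that \<open>t\<close> itself is guarded. Terms in between may
  contain variables outside \<open>dom E\<close>.
\<close>

definition guarded_spec :: "('a, 'x) spec \<Rightarrow> bool" where
  "guarded_spec E \<longleftrightarrow>
     (\<forall>X t. E X = Some t \<longrightarrow>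
        acp_term t \<and> leaves t \<subseteq> dom E \<and>
        (\<exists>t'. (rewr E X)\<^sup>*\<^sup>* t t' \<and> guarded t' \<and> leaves t' \<subseteq> dom E))"

definition rec_term :: "('a, 'x) rtrm \<Rightarrow> bool" where
  "rec_term t \<longleftrightarrow>
     acp_term t \<and> (\<forall>X E. RecConst X E \<in> leaves t \<longrightarrow> guarded_spec E \<and> X \<in> spec_vars E)"

inductive derivable :: "('a, 'x) rtrm \<Rightarrow> ('a, 'x) rtrm \<Rightarrow> bool" where
  ACP: "axiom_inst s t \<Longrightarrow> rec_term s \<Longrightarrow> rec_term t \<Longrightarrow> derivable s t"
| RDP: "guarded_spec E \<Longrightarrow> E X = Some t \<Longrightarrow> derivable \<langle>X|E\<rangle> (close_trm t E)"
| RSP: "guarded_spec E \<Longrightarrow> X \<in> spec_vars E \<Longrightarrow> \<forall>Y. rec_term (\<sigma> Y) \<Longrightarrow>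
    \<forall>Y t. E Y = Some t \<longrightarrow> derivable (\<sigma> Y) (subst \<sigma> t) \<Longrightarrow> derivable (\<sigma> X) \<langle>X|E\<rangle>"
| refl: "rec_term t \<Longrightarrow> derivable t t"
| sym: "derivable s t \<Longrightarrow> derivable t s"
| trans: "derivable s t \<Longrightarrow> derivable t u \<Longrightarrow> derivable s u"
| Alt: "derivable s s' \<Longrightarrow> derivable t t' \<Longrightarrow> derivable (s \<^bold>+ t) (s' \<^bold>+ t')"
| Seq: "derivable s s' \<Longrightarrow> derivable t t' \<Longrightarrow> derivable (s \<^bold>\<cdot> t) (s' \<^bold>\<cdot> t')"
| Par: "derivable s s' \<Longrightarrow> derivable t t' \<Longrightarrow> derivable (s \<^bold>\<parallel> t) (s' \<^bold>\<parallel> t')"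
| LMerge: "derivable s s' \<Longrightarrow> derivable t t' \<Longrightarrow> derivable (s \<^bold>\<lfloor>\<^bold>\<lfloor> t) (s' \<^bold>\<lfloor>\<^bold>\<lfloor> t')"
| Comm: "derivable s s' \<Longrightarrow> derivable t t' \<Longrightarrow> derivable (s \<^bold>\<bar> t) (s' \<^bold>\<bar> t')"
| Encap: "H \<subseteq> A \<Longrightarrow> derivable t t' \<Longrightarrow> derivable (Encap H t) (Encap H t')"

inductive linear :: "('a, 'x) trm \<Rightarrow> bool" where
  delta: "linear (Const \<delta>)"
| act: "a \<in> A \<Longrightarrow> linear (Const a)"
| act_var: "a \<in> A \<Longrightarrow> linear (Const a \<^bold>\<cdot> Var X)"
| alt: "linear s \<Longrightarrow> linear t \<Longrightarrow> linear (s \<^bold>+ t)"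

definition linear_spec :: "('a, 'x) spec \<Rightarrow> bool" where
  "linear_spec E \<longleftrightarrow> guarded_spec E \<and> (\<forall>X t. E X = Some t \<longrightarrow> linear t)"

end

end

theory Submission
  imports Defs "HOL-Combinatorics.Transposition"
begin

text \<open>
  Every closed term of ACP with recursion is derivably equal to a head normal form, i.e. a finite
  sum of terms \<open>a\<close> and \<open>a \<cdot> q\<close> with \<open>q\<close> closed: for a constant \<open>\<langle>X|E\<rangle>\<close>
  the rewriting that guardedness of \<open>E\<close> provides can be mimicked by derivations, since RDP holds for
  all equations of \<open>E\<close>, and it leads to a guarded term, whose operators can be pushed inwards as
  far as the guards. As head normal forms have finitely many successors \<open>q\<close>, only countably many
  terms are reachable from \<open>\<langle>X|E\<rangle>\<close>. Naming these by variables turns their head normal forms into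
  a linear specification \<open>E'\<close> that they solve, and RSP for \<open>E'\<close> yields \<open>\<langle>X|E\<rangle> = \<langle>X|E'\<rangle>\<close>.
\<close>

section \<open>Leaves and substitution\<close>

lemma finite_leaves: "finite (leaves t)"
  by (induction t) auto

lemma leaves_subst: "leaves (subst \<sigma> t) = (\<Union>v\<in>leaves t. leaves (\<sigma> v))"
  by (induction t) auto

lemma subst_cong: "(\<And>v. v \<in> leaves t \<Longrightarrow> \<sigma> v = \<tau> v) \<Longrightarrow> subst \<sigma> t = subst \<tau> t"
  by (induction t) auto

lemma subst_subst: "subst \<tau> (subst \<sigma> t) = subst (\<lambda>v. subst \<tau> (\<sigma> v)) t"
  by (induction t) auto

context acp
begin

lemma axiom_inst_subst: "axiom_inst s t \<Longrightarrow> axiom_inst (subst \<sigma> s) (subst \<sigma> t)"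
  by (induction rule: axiom_inst.induct) (auto intro: axiom_inst.intros)

section \<open>Guarded occurrences\<close>

lemma guarded_arg:
  assumes "guarded t" "i < length (args t)" "i = 1 \<Longrightarrow> \<forall>a u. t \<noteq> Const a \<^bold>\<cdot> u"
  shows "guarded (args t ! i)"
  unfolding guarded_def
proof (intro allI impI)
  fix p X
  assume "subterm_at (args t ! i) p = Some (Var X)"
  with assms(1,2) have "guarded_occ t (i # p)"
    by (simp add: guarded_def)
  then obtain q r a t' where q: "i # p = q @ 1 # r" "a \<in> A" "subterm_at t q = Some (Const a \<^bold>\<cdot> t')"
    unfolding guarded_occ_def by blast
  with assms(3) obtain q' where "q = i # q'"
    by (cases q) auto
  with q assms(2) show "guarded_occ (args t ! i) p"
    unfolding guarded_occ_def by auto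
qed

text \<open>The occurrence is at the empty position, which cannot pass through a guard.\<close>

lemma guarded_Var [simp]: "\<not> guarded (Var v)"
proof
  assume "guarded (Var v)"
  then have "guarded_occ (Var v) []"
    unfolding guarded_def by (metis subterm_at.simps(1))
  then show False
    by (simp add: guarded_occ_def)
qed

lemma guarded_Const: "guarded (Const a)"
  unfolding guarded_def
proof (intro allI impI)
  fix p X
  show "subterm_at (Const a) p = Some (Var X) \<Longrightarrow> guarded_occ (Const a) p"
    by (cases p) auto
qed

text \<open>A guard at the root protects only the second factor of a sequential composition. In all
  other argument places the guards must lie inside the argument itself, so guardedness is
  inherited.\<close>

lemma guarded_argsD:
  "guarded (s \<^bold>+ t) \<Longrightarrow> guarded s \<and> guarded t"
  "guarded (s \<^bold>\<cdot> t) \<Longrightarrow> guarded s"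
  "guarded (s \<^bold>\<parallel> t) \<Longrightarrow> guarded s \<and> guarded t"
  "guarded (s \<^bold>\<lfloor>\<^bold>\<lfloor> t) \<Longrightarrow> guarded s \<and> guarded t"
  "guarded (s \<^bold>\<bar> t) \<Longrightarrow> guarded s \<and> guarded t"
  "guarded (Encap H t) \<Longrightarrow> guarded t"
  using guarded_arg[of "s \<^bold>+ t" 0] guarded_arg[of "s \<^bold>+ t" 1] guarded_arg[of "s \<^bold>\<cdot> t" 0]
    guarded_arg[of "s \<^bold>\<parallel> t" 0] guarded_arg[of "s \<^bold>\<parallel> t" 1]
    guarded_arg[of "s \<^bold>\<lfloor>\<^bold>\<lfloor> t" 0] guarded_arg[of "s \<^bold>\<lfloor>\<^bold>\<lfloor> t" 1]
    guarded_arg[of "s \<^bold>\<bar> t" 0] guarded_arg[of "s \<^bold>\<bar> t" 1] guarded_arg[of "Encap H t" 0]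
  by auto

lemma guarded_occ_Cons:
  assumes "guarded_occ (args t ! i) p" "i < length (args t)"
  shows "guarded_occ t (i # p)"
proof -
  obtain q r a u where "p = q @ 1 # r" "a \<in> A" "subterm_at (args t ! i) q = Some (Const a \<^bold>\<cdot> u)"
    using assms(1) unfolding guarded_occ_def by blast
  with assms(2) have "i # p = (i # q) @ 1 # r \<and> a \<in> A \<and> subterm_at t (i # q) = Some (Const a \<^bold>\<cdot> u)"
    by simp
  then show ?thesis
    unfolding guarded_occ_def by blast
qed

lemma linear_guarded: "linear t \<Longrightarrow> guarded t"
proof (induction rule: linear.induct)
  case delta
  show ?case
    by (rule guarded_Const)
next
  case (act a)
  show ?case
    by (rule guarded_Const)
next
  case (act_var a X)
  show ?case
    unfolding guarded_def
  proof (intro allI impI)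
    fix p Y
    assume p: "subterm_at (Const a \<^bold>\<cdot> Var X) p = Some (Var Y)"
    then obtain i q where "p = i # q" "i < 2" "subterm_at ([Const a, Var X] ! i) q = Some (Var Y)"
      by (cases p) (auto split: if_splits)
    \<comment> \<open>Argument 0 is a constant, so the variable sits in argument 1 and the root, at
      position \<open>[]\<close>, is its guard.\<close>
    then have "p = [] @ 1 # q"
      by (cases q) (auto simp: less_2_cases_iff)
    then show "guarded_occ (Const a \<^bold>\<cdot> Var X) p"
      using act_var unfolding guarded_occ_def
      by (intro exI[of _ "[]"] exI[of _ q] exI[of _ a] exI[of _ "Var X"]) auto
  qed
next
  case (alt s t)
  show ?case
    unfolding guarded_def
  proof (intro allI impI)
    fix p Y
    assume "subterm_at (s \<^bold>+ t) p = Some (Var Y)"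
    then obtain i q where i: "p = i # q" "i < 2" "subterm_at ([s, t] ! i) q = Some (Var Y)"
      by (cases p) (auto split: if_splits)
    with alt have "guarded_occ ([s, t] ! i) q"
      by (auto simp: guarded_def less_2_cases_iff)
    with i show "guarded_occ (s \<^bold>+ t) p"
      using guarded_occ_Cons[of "s \<^bold>+ t" i q] by simp
  qed
qed

lemma spec_vars_guarded: "guarded_spec E \<Longrightarrow> spec_vars E = dom E"
  unfolding guarded_spec_def spec_vars_def ran_def by fast

section \<open>Rewriting mimicked by derivations\<close>

lemma rec_term_simps [simp]:
  "rec_term (Const a) \<longleftrightarrow> a \<in> A\<delta>"
  "rec_term (Var (FVar X))"
  "rec_term \<langle>X|E\<rangle> \<longleftrightarrow> guarded_spec E \<and> X \<in> spec_vars E"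
  "rec_term (s \<^bold>+ t) \<longleftrightarrow> rec_term s \<and> rec_term t"
  "rec_term (s \<^bold>\<cdot> t) \<longleftrightarrow> rec_term s \<and> rec_term t"
  "rec_term (s \<^bold>\<parallel> t) \<longleftrightarrow> rec_term s \<and> rec_term t"
  "rec_term (s \<^bold>\<lfloor>\<^bold>\<lfloor> t) \<longleftrightarrow> rec_term s \<and> rec_term t"
  "rec_term (s \<^bold>\<bar> t) \<longleftrightarrow> rec_term s \<and> rec_term t"
  "rec_term (Encap H t) \<longleftrightarrow> H \<subseteq> A \<and> rec_term t"
  by (auto simp: rec_term_def)

lemma rec_term_close:
  "acp_term t \<Longrightarrow> guarded_spec E \<Longrightarrow> rec_term (close_trm t E)"
  unfolding close_trm_def by (induction t) auto

lemma derivable_rec_term: "derivable s t \<Longrightarrow> rec_term s \<and> rec_term t"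
proof (induction rule: derivable.induct)
  case (RDP E X t)
  then have "acp_term t"
    unfolding guarded_spec_def by blast
  with RDP show ?case
    by (auto simp: rec_term_close spec_vars_guarded)
qed auto

lemma rewr_acp_term: "rewr E X s t \<Longrightarrow> guarded_spec E \<Longrightarrow> acp_term s \<Longrightarrow> acp_term t"
  by (induction rule: rewr.induct) (auto simp: guarded_spec_def)

text \<open>Instances of axioms remain instances after substitution, unfolding \<open>Y\<close>
  becomes RDP for \<open>Y\<close>, and the context rules become congruence. Variables outside
  \<open>spec_vars E\<close>, which may occur on the way, stay free.\<close>

lemma rewr_derivable:
  assumes "rewr E X s t" "guarded_spec E" "acp_term s"
  shows "derivable (close_trm s E) (close_trm t E)"
  using assms
proof (induction rule: rewr.induct)
  case (ax_lr s t)
  then have "rec_term (close_trm s E)" "rec_term (close_trm t E)"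
    by (simp_all add: rec_term_close)
  then show ?case
    using axiom_inst_subst[OF ax_lr(1)] unfolding close_trm_def
    by (blast intro: derivable.ACP)
next
  case (ax_rl t s)
  then have "rec_term (close_trm s E)" "rec_term (close_trm t E)"
    by (simp_all add: rec_term_close)
  then show ?case
    using axiom_inst_subst[OF ax_rl(1)] unfolding close_trm_def
    by (blast intro: derivable.sym[OF derivable.ACP])
next
  case (unfold Y t)
  then have "Y \<in> spec_vars E"
    by (auto simp: spec_vars_guarded)
  with derivable.RDP[OF unfold(3,2)] show ?case
    by (simp add: close_trm_def)
qed (auto simp: close_trm_def intro!: derivable.Alt derivable.Seq derivable.Par derivable.LMerge
    derivable.Comm derivable.Encap intro: derivable.refl rec_term_close[unfolded close_trm_def])

lemma rewrs_derivable:
  assumes "(rewr E X)\<^sup>*\<^sup>* s t" "guarded_spec E" "acp_term s"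
  shows "acp_term t \<and> derivable (close_trm s E) (close_trm t E)"
  using assms(1)
proof induction
  case base
  show ?case
    using assms by (simp add: derivable.refl rec_term_close)
next
  case (step t u)
  with assms(2) show ?case
    by (meson rewr_acp_term rewr_derivable derivable.trans)
qed

section \<open>Closed terms and head normal forms\<close>

definition closed_rec_term :: "('a, 'x) rtrm \<Rightarrow> bool" where
  "closed_rec_term t \<longleftrightarrow> rec_term t \<and> (\<forall>X. FVar X \<notin> leaves t)"

lemma closed_rec_term_simps [simp]:
  "closed_rec_term (Const a) \<longleftrightarrow> a \<in> A\<delta>"
  "\<not> closed_rec_term (Var (FVar X))"
  "closed_rec_term \<langle>X|E\<rangle> \<longleftrightarrow> guarded_spec E \<and> X \<in> spec_vars E"
  "closed_rec_term (s \<^bold>+ t) \<longleftrightarrow> closed_rec_term s \<and> closed_rec_term t"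
  "closed_rec_term (s \<^bold>\<cdot> t) \<longleftrightarrow> closed_rec_term s \<and> closed_rec_term t"
  "closed_rec_term (s \<^bold>\<parallel> t) \<longleftrightarrow> closed_rec_term s \<and> closed_rec_term t"
  "closed_rec_term (s \<^bold>\<lfloor>\<^bold>\<lfloor> t) \<longleftrightarrow> closed_rec_term s \<and> closed_rec_term t"
  "closed_rec_term (s \<^bold>\<bar> t) \<longleftrightarrow> closed_rec_term s \<and> closed_rec_term t"
  "closed_rec_term (Encap H t) \<longleftrightarrow> H \<subseteq> A \<and> closed_rec_term t"
  by (auto simp: closed_rec_term_def)

lemma closed_rec_term_rec_term: "closed_rec_term t \<Longrightarrow> rec_term t"
  by (simp add: closed_rec_term_def)

lemma closed_rec_term_subst:
  "acp_term t \<Longrightarrow> (\<And>v. v \<in> leaves t \<Longrightarrow> closed_rec_term (\<sigma> v)) \<Longrightarrow> closed_rec_term (subst \<sigma> t)"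
  by (induction t) auto

inductive hnf :: "('a, 'x) rtrm \<Rightarrow> bool" where
  const: "a \<in> A\<delta> \<Longrightarrow> hnf (Const a)"
| prefix: "a \<in> A\<delta> \<Longrightarrow> closed_rec_term p \<Longrightarrow> hnf (Const a \<^bold>\<cdot> p)"
| alt: "hnf p \<Longrightarrow> hnf q \<Longrightarrow> hnf (p \<^bold>+ q)"
| deriv: "derivable p q \<Longrightarrow> hnf q \<Longrightarrow> hnf p"

lemma hnf_rec_term: "hnf p \<Longrightarrow> rec_term p"
  by (induction rule: hnf.induct) (auto simp: closed_rec_term_rec_term dest: derivable_rec_term)

text \<open>The form in which axioms push operators inwards, read from left to right.\<close>

lemma hnf_axiom: "axiom_inst p q \<Longrightarrow> rec_term p \<Longrightarrow> hnf q \<Longrightarrow> hnf p"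
  by (meson derivable.ACP hnf.deriv hnf_rec_term)

lemma hnf_Seq: "hnf p \<Longrightarrow> closed_rec_term q \<Longrightarrow> hnf (p \<^bold>\<cdot> q)"
proof (induction rule: hnf.induct)
  case (prefix a p)
  then show ?case
    by (intro hnf_axiom[OF axiom_inst.A5]) (auto intro: hnf.prefix simp: closed_rec_term_rec_term)
next
  case (alt p p')
  then show ?case
    by (intro hnf_axiom[OF axiom_inst.A4])
      (auto intro: hnf.alt simp: closed_rec_term_rec_term hnf_rec_term)
next
  case (deriv p p')
  then show ?case
    by (meson closed_rec_term_rec_term derivable.Seq derivable.refl hnf.deriv)
qed (auto intro: hnf.prefix)

lemma hnf_Encap: "hnf p \<Longrightarrow> H \<subseteq> A \<Longrightarrow> hnf (Encap H p)"
proof (induction rule: hnf.induct)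
  case (const a)
  then show ?case
    by (cases "a \<in> H")
      (auto intro: hnf_axiom[OF axiom_inst.D1] hnf_axiom[OF axiom_inst.D2] hnf.const)
next
  case (prefix a p)
  have "hnf (Encap H (Const a))"
    using prefix by (cases "a \<in> H")
      (auto intro: hnf_axiom[OF axiom_inst.D1] hnf_axiom[OF axiom_inst.D2] hnf.const)
  with prefix show ?case
    by (intro hnf_axiom[OF axiom_inst.D4] hnf_Seq) (auto simp: closed_rec_term_rec_term)
next
  case (alt p p')
  then show ?case
    by (intro hnf_axiom[OF axiom_inst.D3]) (auto intro: hnf.alt simp: hnf_rec_term)
next
  case (deriv p p')
  then show ?case
    by (meson derivable.Encap hnf.deriv)
qed

lemma hnf_LMerge: "hnf p \<Longrightarrow> closed_rec_term q \<Longrightarrow> hnf (p \<^bold>\<lfloor>\<^bold>\<lfloor> q)"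
proof (induction rule: hnf.induct)
  case (const a)
  then show ?case
    by (intro hnf_axiom[OF axiom_inst.CM2]) (auto intro: hnf.prefix simp: closed_rec_term_rec_term)
next
  case (prefix a p)
  then show ?case
    by (intro hnf_axiom[OF axiom_inst.CM3]) (auto intro: hnf.prefix simp: closed_rec_term_rec_term)
next
  case (alt p p')
  then show ?case
    by (intro hnf_axiom[OF axiom_inst.CM4])
      (auto intro: hnf.alt simp: closed_rec_term_rec_term hnf_rec_term)
next
  case (deriv p p')
  then show ?case
    by (meson closed_rec_term_rec_term derivable.LMerge derivable.refl hnf.deriv)
qed

lemma hnf_Comm_Const: "a \<in> A\<delta> \<Longrightarrow> b \<in> A\<delta> \<Longrightarrow> hnf (Const a \<^bold>\<bar> Const b)"
  using gamma_closed[of a b] by (intro hnf_axiom[OF axiom_inst.CF] hnf.const) auto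

text \<open>Unlike the left merge, communication inspects the heads of both operands, hence an
  induction on \<open>q\<close> inside the one on \<open>p\<close>: CM8 and CM9 split sums on either
  side until CF or CM5 to CM7 apply.\<close>

lemma hnf_Comm: "hnf p \<Longrightarrow> hnf q \<Longrightarrow> hnf (p \<^bold>\<bar> q)"
proof (induction arbitrary: q rule: hnf.induct)
  case (const a)
  from const(2,1) show ?case
  proof (induction rule: hnf.induct)
    case (const b)
    then show ?case
      by (intro hnf_Comm_Const)
  next
    case (prefix b q)
    then show ?case
      by (intro hnf_axiom[OF axiom_inst.CM6] hnf_Seq hnf_Comm_Const)
        (auto simp: closed_rec_term_rec_term)
  next
    case (alt q q')
    then show ?case
      by (intro hnf_axiom[OF axiom_inst.CM9]) (auto intro: hnf.alt simp: hnf_rec_term)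
  next
    case (deriv q q')
    then show ?case
      by (meson derivable.Comm derivable.refl hnf.deriv hnf.const hnf_rec_term)
  qed
next
  case (prefix a p)
  from prefix(3,1,2) show ?case
  proof (induction rule: hnf.induct)
    case (const b)
    then show ?case
      by (intro hnf_axiom[OF axiom_inst.CM5] hnf_Seq hnf_Comm_Const)
        (auto simp: closed_rec_term_rec_term)
  next
    case (prefix b q)
    then show ?case
      by (intro hnf_axiom[OF axiom_inst.CM7] hnf_Seq hnf_Comm_Const)
        (auto simp: closed_rec_term_rec_term)
  next
    case (alt q q')
    then show ?case
      by (intro hnf_axiom[OF axiom_inst.CM9])
        (auto intro: hnf.alt simp: hnf_rec_term closed_rec_term_rec_term)
  next
    case (deriv q q')
    then show ?case
      by (meson derivable.Comm derivable.refl hnf.deriv hnf.prefix hnf_rec_term)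
  qed
next
  case (alt p p')
  then show ?case
    by (intro hnf_axiom[OF axiom_inst.CM8]) (auto intro: hnf.alt simp: hnf_rec_term)
next
  case (deriv p p')
  then show ?case
    by (meson derivable.Comm derivable.refl hnf.deriv hnf_rec_term)
qed

lemma hnf_Par:
  "hnf p \<Longrightarrow> hnf q \<Longrightarrow> closed_rec_term p \<Longrightarrow> closed_rec_term q \<Longrightarrow> hnf (p \<^bold>\<parallel> q)"
  by (intro hnf_axiom[OF axiom_inst.CM1] hnf.alt hnf_LMerge hnf_Comm) (auto simp: hnf_rec_term)

text \<open>Induction on \<open>t\<close>, where guardedness excludes the case of a variable. In a
  sequential composition only the first factor must have a head normal form, so the terms put for
  guarded variables need only be closed. This avoids circularity for recursion constants.\<close>

lemma guarded_hnf:
  assumes "guarded t" "acp_term t" "\<forall>v\<in>leaves t. closed_rec_term (\<sigma> v)"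
  shows "hnf (subst \<sigma> t)"
  using assms
proof (induction t)
  case (Seq s t)
  then have "hnf (subst \<sigma> s)" "closed_rec_term (subst \<sigma> t)"
    using guarded_argsD(2) by (auto intro: closed_rec_term_subst)
  then show ?case
    by (simp add: hnf_Seq)
next
  case (Par s t)
  from guarded_argsD(3)[OF Par.prems(1)] Par show ?case
    by (simp add: hnf_Par closed_rec_term_subst)
next
  case (LMerge s t)
  from guarded_argsD(4)[OF LMerge.prems(1)] LMerge show ?case
    by (simp add: hnf_LMerge closed_rec_term_subst)
qed (auto dest!: guarded_argsD intro!: hnf.const hnf.alt hnf_Comm hnf_Encap)

lemma rec_const_hnf:
  assumes "guarded_spec E" "X \<in> spec_vars E"
  shows "hnf \<langle>X|E\<rangle>"
proof -
  obtain t where t: "E X = Some t"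
    using assms by (auto simp: spec_vars_guarded)
  then obtain t' where t': "(rewr E X)\<^sup>*\<^sup>* t t'" "guarded t'" "leaves t' \<subseteq> dom E" "acp_term t"
    using assms(1) unfolding guarded_spec_def by blast
  from rewrs_derivable[OF t'(1) assms(1) t'(4)]
  have "acp_term t'" and derivable: "derivable (close_trm t E) (close_trm t' E)"
    by simp_all
  \<comment> \<open>All variables of \<open>t'\<close> are in \<open>dom E\<close>, so closing
    replaces each of them by a recursion constant.\<close>
  from this(1) t' have "hnf (close_trm t' E)"
    unfolding close_trm_def
    by (intro guarded_hnf) (use assms(1) in \<open>auto simp: spec_vars_guarded\<close>)
  then show ?thesis
    by (rule hnf.deriv[OF derivable.trans[OF derivable.RDP[OF assms(1) t] derivable]])
qed

lemma closed_rec_term_hnf: "closed_rec_term p \<Longrightarrow> hnf p"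
proof (induction p)
  case (Var l)
  then show ?case
    by (cases l) (auto intro: rec_const_hnf)
qed (auto intro: hnf.const hnf.alt hnf_Seq hnf_Encap hnf_LMerge hnf_Comm hnf_Par)

text \<open>
  A head normal form is represented by a linear term whose variables are themselves terms; the
  substitution \<open>\<lambda>q. q\<close> flattens it.
\<close>

lemma hnf_linear:
  assumes "hnf p"
  shows "\<exists>t. linear t \<and> (\<forall>q\<in>leaves t. closed_rec_term q) \<and> derivable p (subst (\<lambda>q. q) t)"
  using assms
proof (induction rule: hnf.induct)
  case (const a)
  then show ?case
    by (intro exI[of _ "Const a"]) (auto intro: linear.intros derivable.refl)
next
  case (prefix a p)
  show ?case
  proof (cases "a = \<delta>")
    \<comment> \<open>Linear terms have no summand with prefix \<open>\<delta>\<close>; A7 reduces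
      it to \<open>\<delta>\<close>.\<close>
    case True
    with prefix show ?thesis
      by (intro exI[of _ "Const \<delta>"])
        (auto intro!: linear.delta derivable.ACP axiom_inst.A7 simp: closed_rec_term_rec_term)
  next
    case False
    with prefix show ?thesis
      by (intro exI[of _ "Const a \<^bold>\<cdot> Var p"])
        (auto intro!: linear.act_var derivable.refl simp: closed_rec_term_rec_term)
  qed
next
  case (alt p q)
  then obtain s t where
    "linear s \<and> (\<forall>q\<in>leaves s. closed_rec_term q) \<and> derivable p (subst (\<lambda>q. q) s)"
    "linear t \<and> (\<forall>q\<in>leaves t. closed_rec_term q) \<and> derivable q (subst (\<lambda>q. q) t)"
    by blast
  then show ?case
    by (intro exI[of _ "s \<^bold>+ t"]) (auto intro: linear.alt derivable.Alt)
next
  case (deriv p q)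
  then show ?case
    by (blast intro: derivable.trans)
qed

section \<open>Countable linear specifications\<close>

lemma linear_acp_term: "linear t \<Longrightarrow> acp_term t"
  by (induction rule: linear.induct) auto

lemma linear_rename: "linear t \<Longrightarrow> linear (subst (\<lambda>v. Var (f v)) t)"
  by (induction rule: linear.induct) (auto intro: linear.intros)

text \<open>Linear terms are already guarded, so zero rewrite steps suffice.\<close>

lemma linear_specI:
  assumes "\<And>X t. E X = Some t \<Longrightarrow> linear t \<and> leaves t \<subseteq> dom E"
  shows "linear_spec E"
  unfolding linear_spec_def guarded_spec_def
  using assms linear_acp_term linear_guarded by blast

lemma closed_rec_term_linear_spec:
  fixes p :: "('a, 'x) rtrm" and X :: 'x
  assumes inf: "infinite (UNIV :: 'x set)" and p: "closed_rec_term p"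
  shows "\<exists>E :: ('a, 'x) spec. linear_spec E \<and> countable (Map.graph E) \<and> X \<in> spec_vars E \<and>
    derivable p \<langle>X|E\<rangle>"
proof -
  \<comment> \<open>Fixing one normal form per term leaves each term with finitely many successors
    in \<open>S\<close>, although it may have many derivably equal normal forms.\<close>
  define nf :: "('a, 'x) rtrm \<Rightarrow> ('a, ('a, 'x) rtrm) trm" where "nf q = (SOME t. linear t \<and>
    (\<forall>r\<in>leaves t. closed_rec_term r) \<and> derivable q (subst (\<lambda>r. r) t))" for q
  have nf: "linear (nf q)" "\<And>r. r \<in> leaves (nf q) \<Longrightarrow> closed_rec_term r"
    "derivable q (subst (\<lambda>r. r) (nf q))" if "closed_rec_term q" for q
    using someI_ex[OF hnf_linear[OF closed_rec_term_hnf[OF that]]] unfolding nf_def by blast+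
  define S where "S = {(q, r). r \<in> leaves (nf q)}"
  define R where "R = S\<^sup>* `` {p}"
  have R_p: "p \<in> R"
    by (simp add: R_def)
  have R_step: "leaves (nf q) \<subseteq> R" if "q \<in> R" for q
    using that by (auto simp: R_def S_def intro: rtrancl_into_rtrancl)
  have R_closed: "closed_rec_term q" if "q \<in> R" for q
  proof -
    from that have "(p, q) \<in> S\<^sup>*"
      by (simp add: R_def)
    then show ?thesis
      by induction (use p nf in \<open>auto simp: S_def\<close>)
  qed
  have "countable R"
    unfolding R_def
  proof (rule countable_rtrancl)
    fix Y :: "('a, 'x) rtrm set"
    assume "countable Y"
    moreover have "S `` Y = (\<Union>q\<in>Y. leaves (nf q))"
      by (auto simp: S_def)
    ultimately show "countable (S `` Y)"
      by (simp add: countable_finite finite_leaves)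
  qed simp
  obtain g :: "nat \<Rightarrow> 'x" where g: "inj g"
    using infinite_countable_subset[OF inf] by blast
  \<comment> \<open>The transposition exchanges the name first allotted to \<open>p\<close> with
    \<open>X\<close>. Thus \<open>p\<close> is named \<open>X\<close> and naming stays injective,
    whether or not \<open>X\<close> was in use.\<close>
  define f where "f = transpose X (g (to_nat_on R p)) \<circ> g \<circ> to_nat_on R"
  have f_p: "f p = X"
    by (simp add: f_def)
  have f_inj: "inj_on f R"
    unfolding f_def using \<open>countable R\<close> g
    by (intro comp_inj_on inj_on_to_nat_on) (auto intro: inj_on_subset)
  define E :: "('a, 'x) spec" where
    "E = (\<lambda>Y. if Y \<in> f ` R then Some (subst (\<lambda>q. Var (f q)) (nf (inv_into R f Y))) else None)"
  have dom_E: "dom E = f ` R"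
    by (auto simp: E_def split: if_splits)
  have linear_E: "linear_spec E"
  proof (rule linear_specI)
    fix Y t
    assume "E Y = Some t"
    then have "Y \<in> f ` R" and t: "t = subst (\<lambda>q. Var (f q)) (nf (inv_into R f Y))"
      by (auto simp: E_def split: if_splits)
    then have "inv_into R f Y \<in> R"
      by (simp add: inv_into_into)
    then show "linear t \<and> leaves t \<subseteq> dom E"
      using R_step nf(1) R_closed by (auto simp: t dom_E leaves_subst intro: linear_rename)
  qed
  then have guarded_E: "guarded_spec E"
    by (simp add: linear_spec_def)
  have X_E: "X \<in> spec_vars E"
    using R_p f_p by (force simp: spec_vars_guarded[OF guarded_E] dom_E)
  \<comment> \<open>The solution of \<open>E\<close>: each name stands for the term it names. The
    default \<open>p\<close> merely makes \<open>\<sigma>\<close> total with legal terms.\<close>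
  define \<sigma> where "\<sigma> Y = (if Y \<in> f ` R then inv_into R f Y else p)" for Y
  have \<sigma>_f: "\<sigma> (f q) = q" if "q \<in> R" for q
    using that f_inj by (simp add: \<sigma>_def)
  have "derivable (\<sigma> X) \<langle>X|E\<rangle>"
  proof (rule derivable.RSP[OF guarded_E X_E])
    show "\<forall>Y. rec_term (\<sigma> Y)"
      by (auto simp: \<sigma>_def inv_into_into R_closed p closed_rec_term_rec_term f_inj)
    show "\<forall>Y t. E Y = Some t \<longrightarrow> derivable (\<sigma> Y) (subst \<sigma> t)"
    proof (intro allI impI)
      fix Y t
      assume "E Y = Some t"
      then obtain q where q: "q \<in> R" "Y = f q" "t = subst (\<lambda>q. Var (f q)) (nf q)"
        using f_inj by (auto simp: E_def split: if_splits)
      \<comment> \<open>Naming by \<open>f\<close> and then applying \<open>\<sigma>\<close> is the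
        identity on \<open>R\<close>, so the premise of RSP is just the equality of \<open>q\<close>
        with its normal form.\<close>
      have "subst \<sigma> t = subst (\<lambda>r. r) (nf q)"
        unfolding q(3) subst_subst using R_step[OF q(1)] by (intro subst_cong) (auto simp: \<sigma>_f)
      then show "derivable (\<sigma> Y) (subst \<sigma> t)"
        using q nf(3) R_closed by (simp add: \<sigma>_f)
    qed
  qed
  moreover have "\<sigma> X = p"
    using \<sigma>_f[OF R_p] f_p by simp
  moreover have "countable (Map.graph E)"
    using \<open>countable R\<close> by (simp add: graph_eq_to_snd_dom dom_E)
  ultimately show ?thesis
    using linear_E X_E by auto
qed

end

theorem theorem1:
  fixes A :: "'a set" and \<delta> :: 'a and \<gamma> :: "'a \<Rightarrow> 'a \<Rightarrow> 'a"
    and E :: "('a, 'x) spec" and X :: 'x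
  assumes "acp A \<delta> \<gamma>"
    and "infinite (UNIV :: 'x set)"
    and "acp.guarded_spec A \<delta> \<gamma> E"
    and "X \<in> spec_vars E"
  shows "\<exists>E' :: ('a, 'x) spec.
    acp.linear_spec A \<delta> \<gamma> E' \<and> countable (Map.graph E') \<and> X \<in> spec_vars E' \<and>
    acp.derivable A \<delta> \<gamma> \<langle>X|E\<rangle> \<langle>X|E'\<rangle>"
proof -
  interpret acp A \<delta> \<gamma>
    by (fact assms(1))
  show ?thesis
    using assms by (intro closed_rec_term_linear_spec) simp_all
qed

end
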